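(* Let $p$ be a constant with $0 \le p < \tfrac12$ or $\tfrac12 < p \le 1$, and let $n$ be even. Inserting the pairs sequence $2,1,4,3,6,5,\ldots,n,n-1$ into an initially empty binary search tree, applying \textsc{RebalanceZig} after each insertion, results in a binary search tree whose expected average node depth is $\Theta(n)$.
   Context: Each new element is first placed as a new leaf $v$ at its standard unbalanced BST position, and then \textsc{RebalanceZig}$(v)$ is applied: while $v$ has a parent and an independent coin flip shows tail (tail has probability $p$, head probability $1-p$), set $v\gets$ parent of $v$; afterwards, if $v$ has a parent, rotate $v$ up (the standard single rotation at the parent of $v$ that moves $v$ one level up). The depth of a node is the number of edges from it to the root; the average node depth is the sum of depths of all $n$ nodes divided by $n$. Expectation is over the coin flips. *)

theory Defs
  imports "HOL-Probability.Probability" "HOL-Library.Tree" "HOL-Library.Landau_Symbols"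
begin

text \<open>
  A node of a tree is identified by its address, the list of directions leading from the root
  to it. The root is \<open>[]\<close>, the parent of a node \<open>v \<noteq> []\<close> is \<open>butlast v\<close>, and the depth of \<open>v\<close> is
  \<open>length v\<close>.
\<close>

datatype dir = L | R

type_synonym address = "dir list"

fun nodes :: "'a tree \<Rightarrow> address set" where
  "nodes Leaf = {}"
| "nodes (Node l x r) = insert [] ((#) L ` nodes l \<union> (#) R ` nodes r)"

definition avg_depth :: "'a tree \<Rightarrow> real" where
  "avg_depth t = (\<Sum>v\<in>nodes t. real (length v)) / real (card (nodes t))"

fun bst_insert :: "'a::linorder \<Rightarrow> 'a tree \<Rightarrow> 'a tree" where
  "bst_insert x Leaf = Node Leaf x Leaf"
| "bst_insert x (Node l y r) =
     (if x < y then Node (bst_insert x l) y r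
      else if y < x then Node l y (bst_insert x r)
      else Node l y r)"

text \<open>The address of the node with key \<open>x\<close>, provided \<open>x\<close> occurs in the search tree.\<close>

fun find_node :: "'a::linorder \<Rightarrow> 'a tree \<Rightarrow> address" where
  "find_node x Leaf = []"
| "find_node x (Node l y r) =
     (if x < y then L # find_node x l
      else if y < x then R # find_node x r
      else [])"

fun rotate_root :: "dir \<Rightarrow> 'a tree \<Rightarrow> 'a tree" where
  "rotate_root L (Node (Node a x b) y c) = Node a x (Node b y c)"
| "rotate_root R (Node a x (Node b y c)) = Node (Node a x b) y c"
| "rotate_root d t = t"

text \<open>The single rotation at the parent of the given node; no change if the node is the root.\<close>

fun rotate_up :: "address \<Rightarrow> 'a tree \<Rightarrow> 'a tree" where
  "rotate_up [] t = t"
| "rotate_up [d] t = rotate_root d t"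
| "rotate_up (L # d # v) (Node l x r) = Node (rotate_up (d # v) l) x r"
| "rotate_up (R # d # v) (Node l x r) = Node l x (rotate_up (d # v) r)"
| "rotate_up (_ # d # v) Leaf = Leaf"

text \<open>The coin shows tail, represented by \<open>True\<close>, with probability \<open>p\<close>.\<close>

function climb :: "real \<Rightarrow> address \<Rightarrow> address pmf" where
  "climb p v =
     (if v = [] then return_pmf v
      else bind_pmf (bernoulli_pmf p)
             (\<lambda>tail. if tail then climb p (butlast v) else return_pmf v))"
  by auto
termination
  by (relation "Wellfounded.measure (\<lambda>(p, v). length v)") auto

declare climb.simps [simp del]

definition rebalance_zig :: "real \<Rightarrow> address \<Rightarrow> 'a tree \<Rightarrow> 'a tree pmf" where
  "rebalance_zig p v t = map_pmf (\<lambda>w. rotate_up w t) (climb p v)"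

definition insert_zig :: "real \<Rightarrow> 'a::linorder \<Rightarrow> 'a tree \<Rightarrow> 'a tree pmf" where
  "insert_zig p x t = (let t' = bst_insert x t in rebalance_zig p (find_node x t') t')"

fun insert_all :: "real \<Rightarrow> 'a::linorder list \<Rightarrow> 'a tree \<Rightarrow> 'a tree pmf" where
  "insert_all p [] t = return_pmf t"
| "insert_all p (x # xs) t = bind_pmf (insert_zig p x t) (insert_all p xs)"

text \<open>For even \<open>n\<close>, the sequence \<open>2, 1, 4, 3, \<dots>, n, n - 1\<close>.\<close>

definition pairs_seq :: "nat \<Rightarrow> nat list" where
  "pairs_seq n = concat (map (\<lambda>i. [2 * i + 2, 2 * i + 1]) [0..<n div 2])"

definition expected_avg_depth :: "real \<Rightarrow> 'a::linorder list \<Rightarrow> real" where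
  "expected_avg_depth p xs = measure_pmf.expectation (insert_all p xs Leaf) avg_depth"

lemma finite_nodes [simp]: "finite (nodes t)"
  by (induction t) auto

lemma card_nodes [simp]: "card (nodes t) = size t"
proof (induction t)
  case (Node l x r)
  have "card ((#) L ` nodes l \<union> (#) R ` nodes r) = size l + size r"
    using Node by (subst card_Un_disjoint) (auto simp: card_image)
  then show ?case by (subst nodes.simps, subst card_insert_disjoint) auto
qed simp

lemma sum_depth_nodes: "(\<Sum>v\<in>nodes t. real (length v)) = real (ipl t)"
proof (induction t)
  case (Node l x r)
  have "(\<Sum>v\<in>(#) L ` nodes l \<union> (#) R ` nodes r. real (length v)) =
      (\<Sum>v\<in>nodes l. real (length v) + 1) + (\<Sum>v\<in>nodes r. real (length v) + 1)"
    by (subst sum.union_disjoint) (auto simp: sum.reindex add.commute)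
  also have "\<dots> = real (ipl l) + real (size l) + (real (ipl r) + real (size r))"
    using Node by (simp add: sum.distrib)
  finally show ?case by (subst nodes.simps, subst sum.insert) auto
qed simp

lemma avg_depth_eq_ipl: "avg_depth t = real (ipl t) / real (size t)"
  by (simp add: avg_depth_def sum_depth_nodes)

end

theory Submission
  imports Defs
begin

text \<open>
  The upper bound is trivial. For the lower bound let \<open>m\<close> and \<open>l\<close> be the numbers of nodes on the right
  and left spine of the tree. Every key \<open>2 k + 2\<close> is appended to the right spine, so each insertion only
  acts near the bottom of the right spine, or rotates one edge of that spine. Inserting one pair changes
  \<open>m\<close> in expectation by \<open>p (1 - 2 p) (2 - p)\<close> plus a nonnegative term of size at most \<open>3 p\<^sup>m\<close>, the
  contribution of climbs that reach the root. Hence \<open>m\<close> has positive drift for \<open>0 < p < 1/2\<close>, and also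
  for \<open>p = 1\<close>. For \<open>1/2 < p < 1\<close> the spine shrinks while it is long, but \<open>l\<close> grows in
  expectation by at least \<open>(1 - p) p\<^bsup>m - 1\<^esup>\<close> through rotations at the root, so \<open>3 l / (1 - p) - m\<close> has
  positive drift. For \<open>p = 0\<close> the left spine below the last node of the right spine grows by two.
  In each case the expected height is linear, and the sum of depths is at least quadratic in the height.
\<close>

section \<open>Trees as lists along the right spine\<close>

text \<open>With a tree read as its list of pairs (left subtree, key) down the right spine, work at
  the bottom of the spine becomes work at the end of a list.\<close>

fun rspine :: "('a tree \<times> 'a) list \<Rightarrow> 'a tree" where
  "rspine [] = Leaf"
| "rspine ((l, x) # ys) = Node l x (rspine ys)"

text \<open>Effect of \<open>rotate_up\<close> at the spine node of depth \<open>i\<close>: the two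
  entries joined by the rotated edge merge into one. Depth 0 is the root, where nothing
  rotates.\<close>

fun rspine_rotate :: "nat \<Rightarrow> ('a tree \<times> 'a) list \<Rightarrow> ('a tree \<times> 'a) list" where
  "rspine_rotate (Suc 0) ((l, x) # (l', x') # ys) = (Node l x l', x') # ys"
| "rspine_rotate (Suc (Suc i)) (y # ys) = y # rspine_rotate (Suc i) ys"
| "rspine_rotate i ys = ys"

fun rlen :: "'a tree \<Rightarrow> nat" where
  "rlen Leaf = 0"
| "rlen (Node l x r) = Suc (rlen r)"

fun llen :: "'a tree \<Rightarrow> nat" where
  "llen Leaf = 0"
| "llen (Node l x r) = Suc (llen l)"

text \<open>The left spine hanging below the last node of the right spine; it serves as the
  potential for \<open>p = 0\<close>.\<close>

fun last_llen :: "'a tree \<Rightarrow> nat" where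
  "last_llen Leaf = 0"
| "last_llen (Node l x r) = (if r = Leaf then llen l else last_llen r)"

text \<open>Mean of \<open>f i\<close> over the stopping depth \<open>i\<close> of a climb from
  depth \<open>d\<close>: each \<open>i > 0\<close> up to \<open>d\<close> has weight
  \<open>(1 - p) * p ^ (d - i)\<close>, and the root has weight \<open>p ^ d\<close>.\<close>

fun climb_mean :: "real \<Rightarrow> nat \<Rightarrow> (nat \<Rightarrow> real) \<Rightarrow> real" where
  "climb_mean p 0 f = f 0"
| "climb_mean p (Suc d) f = (1 - p) * f (Suc d) + p * climb_mean p d f"

lemma rspine_surj: "\<exists>ys. t = rspine ys"
proof (induction t)
  case Leaf
  show ?case by (rule exI[of _ "[]"]) simp
next
  case (Node l x r)
  then obtain ys where "r = rspine ys" by blast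
  then show ?case by (intro exI[of _ "(l, x) # ys"]) simp
qed

lemma rspine_eq_Leaf_iff [simp]: "rspine ys = Leaf \<longleftrightarrow> ys = []"
  by (cases ys rule: rspine.cases) auto

lemma spine_keys_subset: "snd ` set ys \<subseteq> set_tree (rspine ys)"
  by (induction ys rule: rspine.induct) auto

lemma bst_insert_rspine:
  assumes "\<forall>y\<in>snd ` set ys. y < a"
    and "bst_insert a (rspine zs) = rspine zs'"
  shows "bst_insert a (rspine (ys @ zs)) = rspine (ys @ zs')"
  using assms by (induction ys rule: rspine.induct) force+

lemma find_node_rspine:
  assumes "\<forall>y\<in>snd ` set ys. y < b"
  shows "find_node b (rspine (ys @ zs)) = replicate (length ys) R @ find_node b (rspine zs)"
  using assms by (induction ys rule: rspine.induct) force+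

lemma rotate_up_rspine:
  "rotate_up (replicate i R) (rspine ys) = rspine (rspine_rotate i ys)" if "i < length ys"
  using that
proof (induction i ys rule: rspine_rotate.induct)
  case (2 i y ys)
  then show ?case by (cases y) auto
qed auto


text \<open>Since \<open>v\<close> is nonempty, the rotated edge lies inside
  \<open>rspine zs\<close>, and the entries of \<open>ys\<close> are only walked past.\<close>

lemma rotate_up_below_spine:
  assumes "rotate_up v (rspine zs) = rspine zs'" "v \<noteq> []"
  shows "rotate_up (replicate (length ys) R @ v) (rspine (ys @ zs)) = rspine (ys @ zs')"
proof (induction ys rule: rspine.induct)
  case (2 l x ys)
  obtain d w where "replicate (length ys) R @ v = d # w"
    using assms(2) by (cases "replicate (length ys) R @ v") auto
  with 2 show ?case by simp
qed (use assms in simp)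

lemma length_rspine_rotate:
  "i < length ys \<Longrightarrow> length (rspine_rotate i ys) = length ys - (if i = 0 then 0 else 1)"
  by (induction i ys rule: rspine_rotate.induct) auto

lemma rspine_rotate_append:
  "i < length ys \<Longrightarrow> rspine_rotate i (ys @ zs) = rspine_rotate i ys @ zs"
  by (induction i ys rule: rspine_rotate.induct) auto

lemma rspine_rotate_last:
  "rspine_rotate (Suc (length ys)) (ys @ [(l, x), (l', x')]) = ys @ [(Node l x l', x')]"
  by (induction ys) auto

lemma rspine_rotate_keys:
  "snd ` set (rspine_rotate i ys) \<subseteq> snd ` set ys"
  by (induction i ys rule: rspine_rotate.induct) auto

lemma rlen_rspine [simp]: "rlen (rspine ys) = length ys"
  by (induction ys rule: rspine.induct) auto

lemma llen_rspine_append: "ys \<noteq> [] \<Longrightarrow> llen (rspine (ys @ zs)) = llen (rspine ys)"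
  by (cases ys rule: rspine.cases) auto

text \<open>Only the rotation at depth 1 pushes the old root onto the left spine; deeper ones stay
  inside the right subtree of the root.\<close>

lemma llen_rspine_rotate:
  "i < length ys \<Longrightarrow>
     llen (rspine (rspine_rotate i ys)) = llen (rspine ys) + (if i = 1 then 1 else 0)"
proof (induction i ys rule: rspine_rotate.induct)
  case (2 i y ys)
  then show ?case by (cases y) auto
qed auto

lemma last_llen_rspine [simp]: "last_llen (rspine (ys @ [(l, x)])) = llen l"
  by (induction ys rule: rspine.induct) auto

section \<open>Averages over the stopping depth of a climb\<close>

lemma climb_mean_cong:
  "(\<And>i. i \<le> d \<Longrightarrow> f i = g i) \<Longrightarrow> climb_mean p d f = climb_mean p d g"
  by (induction d) auto

lemma climb_mean_mono:
  assumes "0 \<le> p" "p \<le> 1" "\<And>i. i \<le> d \<Longrightarrow> f i \<le> g i"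
  shows "climb_mean p d f \<le> climb_mean p d g"
  using assms(3)
proof (induction d)
  case (Suc d)
  then have "climb_mean p d f \<le> climb_mean p d g" "f (Suc d) \<le> g (Suc d)" by simp_all
  then show ?case using assms(1,2) by (auto intro!: add_mono mult_left_mono)
qed simp

text \<open>A climb from depth \<open>d\<close> reaches the root, and so causes no rotation, with
  probability \<open>p ^ d\<close>.\<close>

lemma climb_mean_moved:
  "climb_mean p d (\<lambda>i. c + (if i = 0 then 0 else e)) = c + e * (1 - p ^ d)"
proof (induction d)
  case (Suc d)
  show ?case by (simp only: climb_mean.simps Suc.IH) (simp add: algebra_simps)
qed simp

text \<open>A climb from depth \<open>d > 0\<close> stops at depth 1 with probability
  \<open>(1 - p) * p ^ (d - 1)\<close>.\<close>

lemma climb_mean_root_rotation: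
  "climb_mean p d (\<lambda>i. c + (if i = 1 then 1 else 0))
     = c + (if d = 0 then 0 else (1 - p) * p ^ (d - 1))"
proof (induction d)
  case (Suc d)
  show ?case unfolding climb_mean.simps Suc.IH by (cases d) (simp_all add: algebra_simps)
qed simp

lemma finite_set_climb: "finite (set_pmf (climb p v))"
proof (induction p v rule: climb.induct)
  case (1 p v)
  then show ?case by (subst climb.simps) auto
qed

lemma finite_set_insert_zig: "finite (set_pmf (insert_zig p x t))"
  by (simp add: insert_zig_def rebalance_zig_def Let_def finite_set_climb)

lemma finite_set_insert_all: "finite (set_pmf (insert_all p xs t))"
  by (induction xs arbitrary: t) (auto simp: finite_set_insert_zig)

lemma expectation_bind_finite:
  fixes f :: "'b \<Rightarrow> real"
  assumes "finite (set_pmf M)" "\<And>x. finite (set_pmf (N x))"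
  shows "measure_pmf.expectation (bind_pmf M N) f
    = measure_pmf.expectation M (\<lambda>x. measure_pmf.expectation (N x) f)"
  using assms
  by (simp add: pmf_expectation_bind[OF assms(1)] integral_measure_pmf_real[OF assms(1)] mult.commute)

lemma expectation_mono_finite:
  fixes f g :: "'b \<Rightarrow> real"
  assumes "finite (set_pmf M)" "\<And>x. x \<in> set_pmf M \<Longrightarrow> f x \<le> g x"
  shows "measure_pmf.expectation M f \<le> measure_pmf.expectation M g"
  by (intro integral_mono_AE integrable_measure_pmf_finite assms AE_pmfI)

lemma expectation_climb_Nil: "measure_pmf.expectation (climb p []) f = (f [] :: real)"
  by (simp add: climb.simps)

lemma expectation_climb_snoc:
  fixes f :: "address \<Rightarrow> real"
  assumes "0 \<le> p" "p \<le> 1"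
  shows "measure_pmf.expectation (climb p (v @ [d])) f
    = (1 - p) * f (v @ [d]) + p * measure_pmf.expectation (climb p v) f"
  using assms
  by (subst climb.simps)
     (simp add: expectation_bind_finite finite_set_climb integral_bernoulli_pmf if_distrib
        cong: if_cong)

lemma expectation_climb_replicate:
  fixes f :: "address \<Rightarrow> real"
  assumes "0 \<le> p" "p \<le> 1"
  shows "measure_pmf.expectation (climb p (replicate d R)) f
    = climb_mean p d (\<lambda>i. f (replicate i R))"
proof (induction d)
  case (Suc d)
  have "replicate (Suc d) R = replicate d R @ [R]"
    by (simp add: replicate_append_same)
  with Suc show ?case
    using expectation_climb_snoc[OF assms, of "replicate d R" R f] by simp
qed (simp add: expectation_climb_Nil)

lemma expectation_insert_zig:
  fixes f :: "'a::linorder tree \<Rightarrow> real"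
  shows "measure_pmf.expectation (insert_zig p x t) f
    = measure_pmf.expectation (climb p (find_node x (bst_insert x t)))
        (\<lambda>w. f (rotate_up w (bst_insert x t)))"
  by (simp add: insert_zig_def rebalance_zig_def Let_def)


section \<open>Insertion of one pair at the bottom of the right spine\<close>

text \<open>Here \<open>a\<close> is the last spine node with no left subtree, and \<open>b\<close>
  enters as its left child. The first term is the rotation of \<open>b\<close> above
  \<open>a\<close>; the second covers the climbs that have moved on to \<open>a\<close>, at depth
  \<open>length ys\<close>.\<close>

definition leaf_step_mean ::
    "real \<Rightarrow> 'a \<Rightarrow> 'a \<Rightarrow> ('a tree \<Rightarrow> real) \<Rightarrow> ('a tree \<times> 'a) list \<Rightarrow> real" where
  "leaf_step_mean p a b f ys =
     (1 - p) * f (rspine (ys @ [(Leaf, b), (Leaf, a)]))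
     + p * climb_mean p (length ys)
         (\<lambda>i. f (rspine (rspine_rotate i (ys @ [(Node Leaf b Leaf, a)]))))"

text \<open>Here \<open>a\<close> has rotated above the old maximum \<open>x\<close>, and
  \<open>b\<close> enters as right child of \<open>x\<close>. The terms are the rotation of
  \<open>b\<close> above \<open>x\<close>, that of \<open>x\<close> above \<open>a\<close>, and the
  climbs that have moved on to \<open>a\<close>.\<close>

definition node_step_mean ::
    "real \<Rightarrow> 'a \<Rightarrow> 'a \<Rightarrow> ('a tree \<Rightarrow> real) \<Rightarrow> ('a tree \<times> 'a) list \<Rightarrow> 'a tree \<Rightarrow> 'a \<Rightarrow> real" where
  "node_step_mean p a b f ys l x =
     (1 - p) * f (rspine (ys @ [(Node (Node l x Leaf) b Leaf, a)]))
     + p * ((1 - p) * f (rspine (ys @ [(l, x), (Node Leaf b Leaf, a)]))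
            + p * climb_mean p (length ys)
                (\<lambda>i. f (rspine (rspine_rotate i (ys @ [(Node l x (Node Leaf b Leaf), a)])))))"

lemma expectation_insert_zig_leaf_step:
  assumes "0 \<le> p" "p \<le> 1" "\<forall>y\<in>snd ` set ys. y < b" "b < a"
  shows "measure_pmf.expectation (insert_zig p b (rspine (ys @ [(Leaf, a)]))) f
    = leaf_step_mean p a b f ys"
proof -
  let ?t = "rspine (ys @ [(Node Leaf b Leaf, a)])"
  have ins: "bst_insert b (rspine (ys @ [(Leaf, a)])) = ?t"
    using assms by (intro bst_insert_rspine) auto
  have find: "find_node b ?t = replicate (length ys) R @ [L]"
    using assms by (subst find_node_rspine) auto
  have rot: "rotate_up (replicate (length ys) R @ [L]) ?t = rspine (ys @ [(Leaf, b), (Leaf, a)])"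
    by (intro rotate_up_below_spine) auto
  have "climb_mean p (length ys) (\<lambda>i. f (rotate_up (replicate i R) ?t))
      = climb_mean p (length ys)
         (\<lambda>i. f (rspine (rspine_rotate i (ys @ [(Node Leaf b Leaf, a)]))))"
    by (intro climb_mean_cong) (simp add: rotate_up_rspine)
  then show ?thesis
    using assms
    by (simp add: expectation_insert_zig ins find rot expectation_climb_snoc
        expectation_climb_replicate leaf_step_mean_def)
qed

lemma expectation_insert_zig_node_step:
  assumes "0 \<le> p" "p \<le> 1" "\<forall>y\<in>snd ` set ys. y < b" "x < b" "b < a"
  shows "measure_pmf.expectation (insert_zig p b (rspine (ys @ [(Node l x Leaf, a)]))) f
    = node_step_mean p a b f ys l x"
proof -
  let ?t = "rspine (ys @ [(Node l x (Node Leaf b Leaf), a)])"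
  have ins: "bst_insert b (rspine (ys @ [(Node l x Leaf, a)])) = ?t"
    using assms by (intro bst_insert_rspine) auto
  have find: "find_node b ?t = (replicate (length ys) R @ [L]) @ [R]"
    using assms by (subst find_node_rspine) auto
  have rot1: "rotate_up ((replicate (length ys) R @ [L]) @ [R]) ?t
      = rspine (ys @ [(Node (Node l x Leaf) b Leaf, a)])"
    unfolding append_assoc by (intro rotate_up_below_spine) auto
  have rot2: "rotate_up (replicate (length ys) R @ [L]) ?t
      = rspine (ys @ [(l, x), (Node Leaf b Leaf, a)])"
    by (intro rotate_up_below_spine) auto
  have "climb_mean p (length ys) (\<lambda>i. f (rotate_up (replicate i R) ?t))
      = climb_mean p (length ys)
         (\<lambda>i. f (rspine (rspine_rotate i (ys @ [(Node l x (Node Leaf b Leaf), a)]))))"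
    by (intro climb_mean_cong) (simp add: rotate_up_rspine)
  then show ?thesis
    using assms
    by (simp only: expectation_insert_zig ins find rot1 rot2 expectation_climb_snoc
        expectation_climb_replicate node_step_mean_def)
qed

text \<open>
  The new maximum \<open>a\<close> either rotates above the old maximum \<open>x\<close>, so that \<open>b\<close> then becomes the right
  child of \<open>x\<close>, or the climb leaves \<open>a\<close> and performs a rotation within the old spine.
\<close>

lemma expectation_insert_pair:
  assumes "0 \<le> p" "p \<le> 1" "\<forall>y\<in>snd ` set (ys @ [(l, x)]). y < b" "b < a"
  shows "measure_pmf.expectation (insert_all p [a, b] (rspine (ys @ [(l, x)]))) f
    = (1 - p) * node_step_mean p a b f ys l x
      + p * climb_mean p (length ys)
          (\<lambda>i. leaf_step_mean p a b f (rspine_rotate i (ys @ [(l, x)])))"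
proof -
  let ?zs = "ys @ [(l, x)]" and ?t = "rspine ((ys @ [(l, x)]) @ [(Leaf, a)])"
  let ?F = "\<lambda>t. measure_pmf.expectation (insert_zig p b t) f"
  have keys: "\<forall>y\<in>snd ` set ?zs. y < a" using assms(3,4) by force
  have ins: "bst_insert a (rspine ?zs) = ?t"
    using bst_insert_rspine[of ?zs a "[]" "[(Leaf, a)]"] keys by simp
  have find: "find_node a ?t = replicate (length ys) R @ [R]"
    using keys by (subst find_node_rspine) (auto simp: replicate_append_same)
  have rot: "rotate_up (replicate (length ys) R @ [R]) ?t = rspine (ys @ [(Node l x Leaf, a)])"
    using rspine_rotate_last[of ys l x Leaf a] rotate_up_rspine[of "Suc (length ys)" "?zs @ [(Leaf, a)]"]
    by (simp add: replicate_append_same)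
  have "climb_mean p (length ys) (\<lambda>i. ?F (rotate_up (replicate i R) ?t))
      = climb_mean p (length ys) (\<lambda>i. leaf_step_mean p a b f (rspine_rotate i ?zs))"
  proof (intro climb_mean_cong)
    fix i assume i: "i \<le> length ys"
    \<comment> \<open>The node \<open>a\<close> sits at depth \<open>length ys + 1\<close>, below
      the rotated edge, so \<open>(Leaf, a)\<close> remains the last entry.\<close>
    have "rotate_up (replicate i R) ?t = rspine (rspine_rotate i ?zs @ [(Leaf, a)])"
      using i by (simp add: rotate_up_rspine rspine_rotate_append del: append_assoc)
    moreover have "\<forall>y\<in>snd ` set (rspine_rotate i ?zs). y < b"
      using rspine_rotate_keys[of i ?zs] assms(3) by blast
    ultimately show "?F (rotate_up (replicate i R) ?t)
        = leaf_step_mean p a b f (rspine_rotate i ?zs)"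
      using expectation_insert_zig_leaf_step assms by metis
  qed
  moreover have "?F (rspine (ys @ [(Node l x Leaf, a)])) = node_step_mean p a b f ys l x"
    using assms by (intro expectation_insert_zig_node_step) auto
  moreover have "measure_pmf.expectation (insert_all p [a, b] (rspine ?zs)) f
      = measure_pmf.expectation (insert_zig p a (rspine ?zs)) ?F"
    by (simp add: expectation_bind_finite finite_set_insert_zig bind_return_pmf')
  ultimately show ?thesis
    using assms(1,2)
    by (simp only: expectation_insert_zig[of p a] ins find rot expectation_climb_snoc
        expectation_climb_replicate)
qed


section \<open>Expected change of the spine lengths\<close>

lemma climb_mean_rlen:
  "climb_mean p (length ys) (\<lambda>i. real (rlen (rspine (rspine_rotate i (ys @ [z])))))
     = real (length ys) + p ^ length ys"
proof -
  have "climb_mean p (length ys) (\<lambda>i. real (rlen (rspine (rspine_rotate i (ys @ [z])))))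
      = climb_mean p (length ys) (\<lambda>i. (real (length ys) + 1) + (if i = 0 then 0 else - 1))"
    by (intro climb_mean_cong) (simp add: length_rspine_rotate)
  then show ?thesis by (simp only: climb_mean_moved) simp
qed

lemma leaf_step_mean_rlen:
  "leaf_step_mean p a b (\<lambda>t. real (rlen t)) ys
     = (1 - p) * (real (length ys) + 2) + p * (real (length ys) + p ^ length ys)"
  unfolding leaf_step_mean_def climb_mean_rlen by simp

lemma node_step_mean_rlen:
  "node_step_mean p a b (\<lambda>t. real (rlen t)) ys l x
     = (1 - p) * (real (length ys) + 1)
       + p * ((1 - p) * (real (length ys) + 2) + p * (real (length ys) + p ^ length ys))"
  unfolding node_step_mean_def climb_mean_rlen by (simp add: add.commute)

text \<open>Climbs reaching the root aside, inserting \<open>a\<close> adds one spine node and its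
  rotation removes one. Then \<open>b\<close> contributes \<open>1 - 2 * p\<close> if
  \<open>a\<close> stayed in place (probability \<open>p\<close>), and
  \<open>p * (1 - 2 * p)\<close> if \<open>a\<close> rotated (probability \<open>1 - p\<close>). The
  weights combine to \<open>p * (2 - p)\<close>; the terms with \<open>q\<close> correct for climbs
  reaching the root.\<close>

lemma expectation_rlen_insert_pair:
  assumes "0 \<le> p" "p \<le> 1" "\<forall>y\<in>snd ` set (ys @ [(l, x)]). y < b" "b < a"
  defines "q \<equiv> p ^ length ys"
  shows "measure_pmf.expectation (insert_all p [a, b] (rspine (ys @ [(l, x)]))) (\<lambda>t. real (rlen t))
    = real (rlen (rspine (ys @ [(l, x)])))
      + p * (1 - 2 * p) * (2 - p) + p * q * (1 + p + p * (1 - p) * (1 - q))"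
proof -
  let ?G = "\<lambda>n. (1 - p) * (real n + 2) + p * (real n + p ^ n)"
  let ?D = "?G (length ys) - ?G (Suc (length ys))"
  have "climb_mean p (length ys)
          (\<lambda>i. leaf_step_mean p a b (\<lambda>t. real (rlen t)) (rspine_rotate i (ys @ [(l, x)])))
      = climb_mean p (length ys) (\<lambda>i. ?G (Suc (length ys)) + (if i = 0 then 0 else ?D))"
    by (intro climb_mean_cong) (auto simp: leaf_step_mean_rlen length_rspine_rotate)
  also have "\<dots> = ?G (Suc (length ys)) + ?D * (1 - q)"
    unfolding climb_mean_moved q_def ..
  finally have *: "climb_mean p (length ys)
          (\<lambda>i. leaf_step_mean p a b (\<lambda>t. real (rlen t)) (rspine_rotate i (ys @ [(l, x)])))
      = ?G (Suc (length ys)) + ?D * (1 - q)" .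
  show ?thesis
    unfolding expectation_insert_pair[OF assms(1-4)] node_step_mean_rlen *
    by (simp add: q_def[symmetric] algebra_simps)
qed

lemma climb_mean_ge:
  assumes "0 \<le> p" "p \<le> 1" "\<And>i. i \<le> d \<Longrightarrow> c \<le> f i"
  shows "c \<le> climb_mean p d f"
  using climb_mean_mono[OF assms(1,2), of d "\<lambda>_. c" f] assms(3) climb_mean_moved[of p d c 0] by simp

lemma convex_combination_ge:
  fixes p u v c :: real
  assumes "0 \<le> p" "p \<le> 1" "c \<le> u" "c \<le> v"
  shows "c \<le> (1 - p) * u + p * v"
proof -
  have "(1 - p) * c + p * c \<le> (1 - p) * u + p * v"
    using assms by (intro add_mono mult_left_mono) auto
  then show ?thesis by (simp add: algebra_simps)
qed

lemma leaf_step_mean_llen_ge: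
  assumes "0 \<le> p" "p \<le> 1" "ys \<noteq> []"
  shows "real (llen (rspine ys)) \<le> leaf_step_mean p a b (\<lambda>t. real (llen t)) ys"
  unfolding leaf_step_mean_def
  by (intro convex_combination_ge climb_mean_ge)
     (use assms in \<open>auto simp: llen_rspine_append llen_rspine_rotate\<close>)

lemma node_step_mean_llen_ge:
  assumes "0 \<le> p" "p \<le> 1"
  shows "real (llen (rspine (ys @ [(l, x)]))) + (if ys = [] then 1 else 0)
    \<le> node_step_mean p a b (\<lambda>t. real (llen t)) ys l x"
proof (cases "ys = []")
  case True
  \<comment> \<open>With a single spine node the mean gain is \<open>2 * (1 - p) + p * p\<close>,
    which exceeds 1 by this square.\<close>
  have "0 \<le> (1 - p)\<^sup>2" by simp
  with True show ?thesis
    by (simp add: node_step_mean_def algebra_simps power2_eq_square)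
next
  case False
  have "real (llen (rspine (ys @ [(l, x)]))) \<le> node_step_mean p a b (\<lambda>t. real (llen t)) ys l x"
    unfolding node_step_mean_def
    by (intro convex_combination_ge climb_mean_ge)
       (use assms False in \<open>auto simp: llen_rspine_append llen_rspine_rotate\<close>)
  with False show ?thesis by simp
qed

text \<open>The climb from \<open>a\<close>, at depth \<open>length ys + 1\<close>, stops at depth 1
  with probability \<open>(1 - p) * p ^ length ys\<close>. That rotation lengthens the left spine by
  one, and the insertion of \<open>b\<close> does not lower this gain in the mean.\<close>

lemma expectation_llen_insert_pair_ge:
  assumes "0 \<le> p" "p \<le> 1" "\<forall>y\<in>snd ` set (ys @ [(l, x)]). y < b" "b < a"
  shows "real (llen (rspine (ys @ [(l, x)]))) + (1 - p) * p ^ length ys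
    \<le> measure_pmf.expectation (insert_all p [a, b] (rspine (ys @ [(l, x)]))) (\<lambda>t. real (llen t))"
proof -
  let ?c = "real (llen (rspine (ys @ [(l, x)])))"
  let ?r = "if length ys = 0 then 0 else (1 - p) * p ^ (length ys - 1)"
  have "?c + ?r = climb_mean p (length ys) (\<lambda>i. ?c + (if i = 1 then 1 else 0))"
    by (simp only: climb_mean_root_rotation)
  also have "\<dots> \<le> climb_mean p (length ys)
      (\<lambda>i. leaf_step_mean p a b (\<lambda>t. real (llen t)) (rspine_rotate i (ys @ [(l, x)])))"
  proof (intro climb_mean_mono assms)
    fix i assume i: "i \<le> length ys"
    have "length (rspine_rotate i (ys @ [(l, x)])) > 0"
      using i by (subst length_rspine_rotate) auto
    moreover have "?c + (if i = 1 then 1 else 0)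
        = real (llen (rspine (rspine_rotate i (ys @ [(l, x)]))))"
      using i by (simp add: llen_rspine_rotate)
    ultimately show "?c + (if i = 1 then 1 else 0)
        \<le> leaf_step_mean p a b (\<lambda>t. real (llen t)) (rspine_rotate i (ys @ [(l, x)]))"
      using leaf_step_mean_llen_ge[OF assms(1,2)] by (metis length_greater_0_conv)
  qed
  finally have "(1 - p) * (?c + (if ys = [] then 1 else 0)) + p * (?c + ?r)
      \<le> measure_pmf.expectation (insert_all p [a, b] (rspine (ys @ [(l, x)]))) (\<lambda>t. real (llen t))"
    unfolding expectation_insert_pair[OF assms] using assms(1,2)
    by (intro add_mono mult_left_mono node_step_mean_llen_ge) auto
  moreover have "(1 - p) * (?c + (if ys = [] then 1 else 0)) + p * (?c + ?r)
      = ?c + (1 - p) * p ^ length ys"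
    by (cases ys) (auto simp: algebra_simps)
  ultimately show ?thesis by simp
qed

text \<open>For \<open>p = 0\<close> each new node rotates at once: \<open>a\<close> above
  \<open>x\<close>, then \<open>b\<close> above \<open>x\<close> but below \<open>a\<close>. Hence
  \<open>b\<close> and \<open>x\<close> extend the left spine under the last node.\<close>

lemma expectation_last_llen_insert_pair:
  assumes "\<forall>y\<in>snd ` set (ys @ [(l, x)]). y < b" "b < a"
  shows "measure_pmf.expectation (insert_all 0 [a, b] (rspine (ys @ [(l, x)])))
      (\<lambda>t. real (last_llen t))
    = real (last_llen (rspine (ys @ [(l, x)]))) + 2"
  using expectation_insert_pair[OF _ _ assms, of 0 "\<lambda>t. real (last_llen t)"]
  by (simp add: node_step_mean_def)

section \<open>A potential with positive drift\<close>

text \<open>The bound by the height turns growth of \<open>W\<close> into growth of the height; the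
  bound by the size controls the value from which the drift starts.\<close>

lemma drift_potential_exists:
  fixes p :: real
  assumes "0 \<le> p \<and> p < 1 / 2 \<or> 1 / 2 < p \<and> p \<le> 1"
  obtains W :: "nat tree \<Rightarrow> real" and \<delta> K :: real where
    "\<delta> > 0" "K > 0" "\<And>t. W t \<le> K * real (height t)" "\<And>t. - real (size t) \<le> W t"
    "\<And>t a b. t \<noteq> Leaf \<Longrightarrow> \<forall>y\<in>set_tree t. y < b \<Longrightarrow> b < a \<Longrightarrow>
       W t + \<delta> \<le> measure_pmf.expectation (insert_all p [a, b] t) W"
proof -
  note potentialI = that
  \<comment> \<open>Every nonempty tree splits off its last spine node, so the drift need only be
    checked in the form to which the expectation formulas apply.\<close>
  have spine: thesis
    if "\<delta> > 0" "K > 0" "\<And>t. W t \<le> K * real (height t)" "\<And>t. - real (size t) \<le> W t"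
      and drift: "\<And>ys l x a b. \<forall>y\<in>snd ` set (ys @ [(l, x)]). y < b \<Longrightarrow> b < a \<Longrightarrow>
        W (rspine (ys @ [(l, x)])) + \<delta>
          \<le> measure_pmf.expectation (insert_all p [a, b] (rspine (ys @ [(l, x)]))) W"
    for W :: "nat tree \<Rightarrow> real" and \<delta> K :: real
  proof (rule potentialI[of \<delta> K W])
    fix t a b assume t: "t \<noteq> Leaf" "\<forall>y\<in>set_tree t. y < b" "b < (a :: nat)"
    obtain zs where zs: "t = rspine zs" using rspine_surj by blast
    with t(1) obtain ys l x where "zs = ys @ [(l, x)]"
      by (cases zs rule: rev_cases) auto
    moreover have "\<forall>y\<in>snd ` set zs. y < b"
      using t(2) spine_keys_subset[of zs] zs by blast
    ultimately show "W t + \<delta> \<le> measure_pmf.expectation (insert_all p [a, b] t) W"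
      using drift[of ys l x b a] t(3) zs by simp
  qed (use that in auto)
  have rlen_height: "rlen t \<le> height t" for t :: "nat tree"
    by (induction t) auto
  have llen_height: "llen t \<le> height t" for t :: "nat tree"
    by (induction t) auto
  have last_llen_height: "last_llen t \<le> height t" for t :: "nat tree"
  proof (induction t)
    case (Node l x r)
    then show ?case using llen_height[of l] by auto
  qed simp
  have p01: "0 \<le> p" "p \<le> 1" using assms by auto
  consider "p = 0" | "0 < p" "p < 1 / 2" | "p = 1" | "1 / 2 < p" "p < 1"
    using assms by fastforce
  then show thesis
  proof cases
    case 1
    show thesis
    proof (rule spine[of 2 1 "\<lambda>t. real (last_llen t)"])
      fix ys :: "(nat tree \<times> nat) list" and l x a b assume "\<forall>y\<in>snd ` set (ys @ [(l, x)]). y < b" "b < (a :: nat)"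
      from expectation_last_llen_insert_pair[OF this]
      show "real (last_llen (rspine (ys @ [(l, x)]))) + 2
        \<le> measure_pmf.expectation (insert_all p [a, b] (rspine (ys @ [(l, x)])))
            (\<lambda>t. real (last_llen t))"
        using 1 by simp
    qed (simp_all add: last_llen_height)
  next
    case 2
    show thesis
    proof (rule spine[of "p * (1 - 2 * p) * (2 - p)" 1 "\<lambda>t. real (rlen t)"])
      fix ys :: "(nat tree \<times> nat) list" and l x a b assume "\<forall>y\<in>snd ` set (ys @ [(l, x)]). y < b" "b < (a :: nat)"
      note E = expectation_rlen_insert_pair[OF p01 this]
      have "0 \<le> p * p ^ length ys * (1 + p + p * (1 - p) * (1 - p ^ length ys))"
        using p01 by (intro mult_nonneg_nonneg add_nonneg_nonneg) (auto intro: power_le_one)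
      then show "real (rlen (rspine (ys @ [(l, x)]))) + p * (1 - 2 * p) * (2 - p)
        \<le> measure_pmf.expectation (insert_all p [a, b] (rspine (ys @ [(l, x)])))
            (\<lambda>t. real (rlen t))"
        using E by linarith
    qed (use 2 in \<open>simp_all add: rlen_height\<close>)
  next
    case 3
    show thesis
    proof (rule spine[of 1 1 "\<lambda>t. real (rlen t)"])
      fix ys :: "(nat tree \<times> nat) list" and l x a b assume "\<forall>y\<in>snd ` set (ys @ [(l, x)]). y < b" "b < (a :: nat)"
      \<comment> \<open>At \<open>p = 1\<close> the root is always reached: the term
        \<open>-1\<close> is outweighed by a root term of 2.\<close>
      from expectation_rlen_insert_pair[OF p01 this]
      show "real (rlen (rspine (ys @ [(l, x)]))) + 1
        \<le> measure_pmf.expectation (insert_all p [a, b] (rspine (ys @ [(l, x)])))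
            (\<lambda>t. real (rlen t))"
        using 3 by simp
    qed (simp_all add: rlen_height)
  next
    case 4
    \<comment> \<open>This factor scales the gain \<open>(1 - p) * p ^ length ys\<close> of the left
      spine to \<open>3 * p ^ length ys\<close>, which bounds the root term of the right
      spine.\<close>
    let ?K = "3 / (1 - p)"
    show thesis
    proof (rule spine[of "p * (2 * p - 1) * (2 - p)" ?K "\<lambda>t. ?K * real (llen t) - real (rlen t)"])
      fix t :: "nat tree"
      have "?K * real (llen t) \<le> ?K * real (height t)"
        using 4 llen_height[of t] by (intro mult_left_mono) auto
      then show "?K * real (llen t) - real (rlen t) \<le> ?K * real (height t)" by simp
      have "real (rlen t) \<le> real (size t)"
        using rlen_height[of t] height_le_size_tree[of t] by linarith
      moreover have "0 \<le> ?K * real (llen t)" using 4 by simp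
      ultimately show "- real (size t) \<le> ?K * real (llen t) - real (rlen t)" by linarith
    next
      fix ys :: "(nat tree \<times> nat) list" and l x a b assume keys: "\<forall>y\<in>snd ` set (ys @ [(l, x)]). y < b" "b < (a :: nat)"
      let ?t = "rspine (ys @ [(l, x)])" and ?q = "p ^ length ys"
      let ?M = "insert_all p [a, b] ?t"
      have "p * (1 - p) * (1 - ?q) \<le> 1"
        using p01 by (intro mult_le_one) (auto intro: power_le_one mult_nonneg_nonneg)
      then have "p * ?q * (1 + p + p * (1 - p) * (1 - ?q)) \<le> p * ?q * 3"
        using p01 by (intro mult_left_mono) auto
      also have "\<dots> \<le> 3 * ?q"
        using p01 by (simp add: mult_left_le_one_le)
      finally have m: "measure_pmf.expectation ?M (\<lambda>t. real (rlen t))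
          \<le> real (rlen ?t) - p * (2 * p - 1) * (2 - p) + 3 * ?q"
        using expectation_rlen_insert_pair[OF p01 keys] by (simp add: algebra_simps)
      have "?K * (real (llen ?t) + (1 - p) * ?q)
          \<le> ?K * measure_pmf.expectation ?M (\<lambda>t. real (llen t))"
        using 4 by (intro mult_left_mono expectation_llen_insert_pair_ge p01 keys) auto
      moreover have "?K * (real (llen ?t) + (1 - p) * ?q) = ?K * real (llen ?t) + 3 * ?q"
        using 4 by (simp add: field_simps)
      moreover have "measure_pmf.expectation ?M (\<lambda>t. ?K * real (llen t) - real (rlen t))
          = ?K * measure_pmf.expectation ?M (\<lambda>t. real (llen t))
            - measure_pmf.expectation ?M (\<lambda>t. real (rlen t))"
        by (subst Bochner_Integration.integral_diff)
           (auto intro!: integrable_measure_pmf_finite finite_set_insert_all simp del: insert_all.simps)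
      ultimately show "?K * real (llen ?t) - real (rlen ?t) + p * (2 * p - 1) * (2 - p)
          \<le> measure_pmf.expectation ?M (\<lambda>t. ?K * real (llen t) - real (rlen t))"
        using m by linarith
    qed (use 4 in simp_all)
  qed
qed


section \<open>Keys, sizes and path length\<close>

lemma set_tree_rotate_root [simp]: "set_tree (rotate_root d t) = set_tree t"
  by (cases "(d, t)" rule: rotate_root.cases) auto

lemma set_tree_rotate_up [simp]: "set_tree (rotate_up v t) = set_tree t"
  by (induction v t rule: rotate_up.induct) auto

lemma size_rotate_root [simp]: "size (rotate_root d t) = size t"
  by (cases "(d, t)" rule: rotate_root.cases) auto

lemma size_rotate_up [simp]: "size (rotate_up v t) = size t"
  by (induction v t rule: rotate_up.induct) auto

lemma set_tree_bst_insert [simp]: "set_tree (bst_insert x t) = insert x (set_tree t)"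
  by (induction t) auto

lemma size_bst_insert_le: "size (bst_insert x t) \<le> Suc (size t)"
  by (induction t) auto

lemma set_tree_insert_zig:
  "t' \<in> set_pmf (insert_zig p x t) \<Longrightarrow> set_tree t' = insert x (set_tree t)"
  by (auto simp: insert_zig_def rebalance_zig_def Let_def)

lemma size_insert_zig_le: "t' \<in> set_pmf (insert_zig p x t) \<Longrightarrow> size t' \<le> Suc (size t)"
  using size_bst_insert_le by (auto simp: insert_zig_def rebalance_zig_def Let_def)

lemma set_tree_insert_all:
  "t' \<in> set_pmf (insert_all p xs t) \<Longrightarrow> set_tree t' = set xs \<union> set_tree t"
  by (induction xs arbitrary: t) (fastforce dest: set_tree_insert_zig)+

lemma size_insert_all_le:
  "t' \<in> set_pmf (insert_all p xs t) \<Longrightarrow> size t' \<le> length xs + size t"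
  by (induction xs arbitrary: t) (fastforce dest: size_insert_zig_le)+

lemma insert_all_append:
  "insert_all p (xs @ ys) t = bind_pmf (insert_all p xs t) (insert_all p ys)"
  by (induction xs arbitrary: t) (auto simp: bind_assoc_pmf bind_return_pmf intro!: bind_pmf_cong)

lemma ipl_le_size_squared: "ipl t \<le> size t * size t"
  by (induction t) (auto simp: algebra_simps)

text \<open>A longest path visits the depths 0 to h - 1, whose sum is h (h - 1) / 2.\<close>

lemma height_squared_le_ipl: "height t * height t \<le> 2 * ipl t + height t"
proof (induction t)
  case (Node l x r)
  show ?case
    \<comment> \<open>Passing from the higher subtree, of height h, to the whole tree raises the
      required doubled path length by 2 h; the added sizes of the subtrees supply it.\<close>
    using Node height_le_size_tree[of l] height_le_size_tree[of r]
    by (cases "height l \<le> height r") (auto simp: max_def algebra_simps)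
qed simp

lemma length_pairs_seq: "even n \<Longrightarrow> length (pairs_seq n) = n"
  by (auto simp: pairs_seq_def length_concat comp_def sum_list_triv)

section \<open>Iterating the drift\<close>

text \<open>Induction on the number of pairs. The key bound \<open>2 * k\<close> places the next
  pair above all stored keys and becomes \<open>2 * Suc k\<close> afterwards.\<close>

lemma expectation_insert_pairs_ge:
  fixes W :: "nat tree \<Rightarrow> real"
  assumes drift: "\<And>t a b. t \<noteq> Leaf \<Longrightarrow> \<forall>y\<in>set_tree t. y < b \<Longrightarrow> b < a \<Longrightarrow>
       W t + \<delta> \<le> measure_pmf.expectation (insert_all p [a, b] t) W"
    and "t \<noteq> Leaf" "set_tree t \<subseteq> {..2 * k}"
  shows "W t + \<delta> * real j \<le> measure_pmf.expectation
    (insert_all p (concat (map (\<lambda>i. [2 * i + 2, 2 * i + 1]) [k..<k + j])) t) W"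
  using assms(2,3)
proof (induction j arbitrary: t k)
  case (Suc j)
  let ?xs = "concat (map (\<lambda>i. [2 * i + 2, 2 * i + 1]) [Suc k..<Suc k + j])"
  let ?M = "insert_all p [2 * k + 2, 2 * k + 1] t"
  have "concat (map (\<lambda>i. [2 * i + 2, 2 * i + 1]) [k..<k + Suc j])
      = [2 * k + 2, 2 * k + 1] @ ?xs"
    by (subst upt_conv_Cons) auto
  then have "measure_pmf.expectation
      (insert_all p (concat (map (\<lambda>i. [2 * i + 2, 2 * i + 1]) [k..<k + Suc j])) t) W
      = measure_pmf.expectation ?M (\<lambda>t'. measure_pmf.expectation (insert_all p ?xs t') W)"
    by (simp only: insert_all_append expectation_bind_finite finite_set_insert_all)
  also have "\<dots> \<ge> measure_pmf.expectation ?M (\<lambda>t'. W t' + \<delta> * real j)"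
  proof (intro expectation_mono_finite finite_set_insert_all)
    fix t' assume "t' \<in> set_pmf ?M"
    from set_tree_insert_all[OF this] Suc.prems(2)
    have "set_tree t' \<subseteq> {..2 * Suc k}" "t' \<noteq> Leaf" by auto
    then show "W t' + \<delta> * real j \<le> measure_pmf.expectation (insert_all p ?xs t') W"
      by (intro Suc.IH)
  qed
  also have "measure_pmf.expectation ?M (\<lambda>t'. W t' + \<delta> * real j)
      = measure_pmf.expectation ?M W + \<delta> * real j"
    by (subst Bochner_Integration.integral_add)
       (auto intro!: integrable_measure_pmf_finite finite_set_insert_all simp del: insert_all.simps)
  also have "\<dots> \<ge> W t + \<delta> + \<delta> * real j"
    using Suc.prems by (intro add_right_mono drift) force+
  finally show ?case by (simp add: algebra_simps)
qed simp

lemma expectation_height_pairs_seq_ge: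
  fixes p :: real
  assumes "0 \<le> p \<and> p < 1 / 2 \<or> 1 / 2 < p \<and> p \<le> 1"
  obtains c C :: real where "c > 0"
    "\<And>n. even n \<Longrightarrow> n > 0 \<Longrightarrow> c * real n - C
       \<le> measure_pmf.expectation (insert_all p (pairs_seq n) Leaf) (\<lambda>t. real (height t))"
proof (rule drift_potential_exists[OF assms])
  fix W :: "nat tree \<Rightarrow> real" and \<delta> K :: real
  assume W:
    "\<delta> > 0" "K > 0" "\<And>t. W t \<le> K * real (height t)" "\<And>t. - real (size t) \<le> W t"
    "\<And>t a b. t \<noteq> Leaf \<Longrightarrow> \<forall>y\<in>set_tree t. y < b \<Longrightarrow> b < a \<Longrightarrow>
       W t + \<delta> \<le> measure_pmf.expectation (insert_all p [a, b] t) W"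
  show thesis
  \<comment> \<open>After the first pair \<open>N = n / 2 - 1\<close> pairs remain, and dividing
    \<open>- 2 + \<delta> * N\<close> by \<open>K\<close> gives these constants.\<close>
  proof (rule that[of "\<delta> / (2 * K)" "(2 + \<delta>) / K"])
    show "0 < \<delta> / (2 * K)" using W(1,2) by simp
  next
    fix n :: nat assume "even n" "n > 0"
    then obtain N where n: "n = 2 * Suc N" by (metis dvdE gr0_conv_Suc nat_0_less_mult_iff)
    let ?M = "insert_all p (pairs_seq n) Leaf" and ?M1 = "insert_all p [2, 1 :: nat] Leaf"
    \<comment> \<open>The drift starts from a nonempty tree, so the first pair is split off; its at
      most two nodes give the start value -2.\<close>
    let ?xs = "concat (map (\<lambda>i. [2 * i + 2, 2 * i + 1]) [1..<1 + N])"
    have "pairs_seq n = [2, 1] @ ?xs"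
      unfolding pairs_seq_def n by (simp add: upt_conv_Cons del: upt_Suc)
    then have "measure_pmf.expectation ?M W
        = measure_pmf.expectation ?M1 (\<lambda>t. measure_pmf.expectation (insert_all p ?xs t) W)"
      by (simp only: insert_all_append expectation_bind_finite finite_set_insert_all)
    also have "\<dots> \<ge> measure_pmf.expectation ?M1 (\<lambda>_. - 2 + \<delta> * real N)"
    proof (intro expectation_mono_finite finite_set_insert_all)
      fix t assume t: "t \<in> set_pmf ?M1"
      have "set_tree t = {1, 2}" "size t \<le> 2"
        using set_tree_insert_all[OF t] size_insert_all_le[OF t] by auto
      then have "t \<noteq> Leaf" "set_tree t \<subseteq> {..2 * 1}" "- 2 \<le> W t"
        using W(4)[of t] by auto
      moreover from this(1,2)
      have "W t + \<delta> * real N \<le> measure_pmf.expectation (insert_all p ?xs t) W"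
        by (intro expectation_insert_pairs_ge W(5))
      ultimately show "- 2 + \<delta> * real N \<le> measure_pmf.expectation (insert_all p ?xs t) W" by simp
    qed
    finally have "- 2 + \<delta> * real N \<le> measure_pmf.expectation ?M W" by simp
    also have "\<dots> \<le> measure_pmf.expectation ?M (\<lambda>t. K * real (height t))"
      by (intro expectation_mono_finite finite_set_insert_all W)
    also have "\<dots> = K * measure_pmf.expectation ?M (\<lambda>t. real (height t))" by simp
    finally have "(- 2 + \<delta> * real N) / K \<le> measure_pmf.expectation ?M (\<lambda>t. real (height t))"
      using W(2) by (simp add: divide_le_eq mult.commute)
    moreover have "\<delta> / (2 * K) * real n - (2 + \<delta>) / K = (- 2 + \<delta> * real N) / K"
      using W(2) by (simp add: n field_simps)
    ultimately show "\<delta> / (2 * K) * real n - (2 + \<delta>) / K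
        \<le> measure_pmf.expectation ?M (\<lambda>t. real (height t))"
      by simp
  qed
qed

section \<open>Bounds on the expected average depth\<close>

lemma expected_avg_depth_le: "expected_avg_depth p xs \<le> real (length xs)"
proof -
  have "expected_avg_depth p xs
      \<le> measure_pmf.expectation (insert_all p xs Leaf) (\<lambda>_. real (length xs))"
    unfolding expected_avg_depth_def
  proof (intro expectation_mono_finite finite_set_insert_all)
    fix t assume t: "t \<in> set_pmf (insert_all p xs Leaf)"
    have "real (ipl t) \<le> real (size t) * real (size t)"
      using ipl_le_size_squared[of t] by (metis of_nat_le_iff of_nat_mult)
    then have "avg_depth t \<le> real (size t)"
      by (cases "size t = 0") (auto simp: avg_depth_eq_ipl divide_le_eq)
    also have "\<dots> \<le> real (length xs)" using size_insert_all_le[OF t] by simp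
    finally show "avg_depth t \<le> real (length xs)" .
  qed
  then show ?thesis by simp
qed

lemma expected_avg_depth_nonneg: "0 \<le> expected_avg_depth p xs"
  unfolding expected_avg_depth_def by (intro integral_nonneg_AE) (simp add: avg_depth_eq_ipl)

text \<open>Uses the tangent bound \<open>h\<^sup>2 \<ge> 2 a h - a\<^sup>2\<close> in place of Jensen's inequality.\<close>

lemma expected_avg_depth_ge_height:
  assumes "xs \<noteq> []" "1 \<le> a"
    "a \<le> measure_pmf.expectation (insert_all p xs Leaf) (\<lambda>t. real (height t))"
  shows "(a\<^sup>2 - a) / (2 * real (length xs)) \<le> expected_avg_depth p xs"
proof -
  let ?M = "insert_all p xs Leaf" and ?n = "real (length xs)"
  let ?\<mu> = "measure_pmf.expectation ?M (\<lambda>t. real (height t))"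
  have "a\<^sup>2 - a \<le> (2 * a - 1) * ?\<mu> - a\<^sup>2"
    \<comment> \<open>The tangent value is increasing in the mean height, as
      \<open>2 * a - 1\<close> is positive, so the mean may be replaced by \<open>a\<close>.\<close>
    using mult_left_mono[OF assms(3), of "2 * a - 1"] assms(2)
    by (simp add: algebra_simps power2_eq_square)
  then have "(a\<^sup>2 - a) / (2 * ?n) \<le> ((2 * a - 1) * ?\<mu> - a\<^sup>2) / (2 * ?n)"
    by (intro divide_right_mono) auto
  also have "\<dots> = measure_pmf.expectation ?M
      (\<lambda>t. ((2 * a - 1) * real (height t) - a\<^sup>2) / (2 * ?n))"
    by (simp add: integrable_measure_pmf_finite finite_set_insert_all)
  also have "\<dots> \<le> expected_avg_depth p xs"
    unfolding expected_avg_depth_def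
  proof (intro expectation_mono_finite finite_set_insert_all)
    fix t assume t: "t \<in> set_pmf ?M"
    let ?h = "real (height t)"
    have "0 \<le> (?h - a)\<^sup>2" by simp
    moreover have "?h * ?h \<le> 2 * real (ipl t) + ?h"
      using height_squared_le_ipl[of t] by (metis of_nat_add of_nat_le_iff of_nat_mult of_nat_numeral)
    ultimately have "(2 * a - 1) * ?h - a\<^sup>2 \<le> 2 * real (ipl t)"
      by (simp add: algebra_simps power2_eq_square)
    then have "((2 * a - 1) * ?h - a\<^sup>2) / (2 * ?n) \<le> 2 * real (ipl t) / (2 * ?n)"
      by (intro divide_right_mono) auto
    \<comment> \<open>The size is at most \<open>length xs\<close>, so dividing by the size gives no
      less; an empty tree makes both sides 0.\<close>
    also have "\<dots> \<le> real (ipl t) / real (size t)"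
    proof (cases "size t = 0")
      case False
      then have "0 < size t" by (metis gr0I)
      then have "real (ipl t) / real (length xs) \<le> real (ipl t) / real (size t)"
        using size_insert_all_le[OF t] by (intro divide_left_mono mult_pos_pos) auto
      then show ?thesis by simp
    qed simp
    finally show "((2 * a - 1) * ?h - a\<^sup>2) / (2 * ?n) \<le> avg_depth t"
      by (simp add: avg_depth_eq_ipl)
  qed
  finally show ?thesis .
qed

theorem theorem4:
  fixes p :: real
  assumes "0 \<le> p \<and> p < 1 / 2 \<or> 1 / 2 < p \<and> p \<le> 1"
  shows "(\<lambda>n. expected_avg_depth p (pairs_seq n))
           \<in> \<Theta>[inf at_top (principal {n. even n})](\<lambda>n. real n)"
proof (rule bigthetaI)
  show "(\<lambda>n. expected_avg_depth p (pairs_seq n)) \<in> O[inf at_top (principal {n. even n})](\<lambda>n. real n)"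
  proof (rule bigoI[of _ 1])
    show "\<forall>\<^sub>F n in inf at_top (principal {n. even n}).
        norm (expected_avg_depth p (pairs_seq n)) \<le> 1 * norm (real n)"
      unfolding eventually_inf_principal
    proof (intro always_eventually allI impI)
      fix n :: nat assume "n \<in> {n. even n}"
      then show "norm (expected_avg_depth p (pairs_seq n)) \<le> 1 * norm (real n)"
        using expected_avg_depth_le[of p "pairs_seq n"]
        by (simp add: expected_avg_depth_nonneg length_pairs_seq)
    qed
  qed
next
  obtain c C :: real where c: "c > 0" and height: "\<And>n. even n \<Longrightarrow> n > 0 \<Longrightarrow> c * real n - C
       \<le> measure_pmf.expectation (insert_all p (pairs_seq n) Leaf) (\<lambda>t. real (height t))"
    by (rule expectation_height_pairs_seq_ge[OF assms]) (rule that; blast)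
  show "(\<lambda>n. expected_avg_depth p (pairs_seq n)) \<in> \<Omega>[inf at_top (principal {n. even n})](\<lambda>n. real n)"
  \<comment> \<open>With \<open>a = c * n / 2\<close> and \<open>a \<ge> 2\<close>, the numerator
    \<open>a * a - a\<close> is at least \<open>a * a / 2\<close>; divided by \<open>2 * n\<close>
    this is \<open>c * c * n / 16\<close>.\<close>
  proof (rule landau_omega.bigI[of "c\<^sup>2 / 16"])
    have "\<forall>\<^sub>F n in at_top. real n \<ge> max 1 (max (4 / c) (2 * C / c))"
      using filterlim_real_sequentially unfolding filterlim_at_top by blast
    then show "\<forall>\<^sub>F n in inf at_top (principal {n. even n}).
        norm (expected_avg_depth p (pairs_seq n)) \<ge> c\<^sup>2 / 16 * norm (real n)"
      unfolding eventually_inf_principal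
    proof (eventually_elim, intro impI)
      fix n assume n: "real n \<ge> max 1 (max (4 / c) (2 * C / c))" and "n \<in> {n. even n}"
      then have even: "even n" and pos: "n > 0" by auto
      \<comment> \<open>Half of the linear term is kept as \<open>a\<close>; the other half absorbs
        \<open>C\<close> once \<open>n \<ge> 2 * C / c\<close>.\<close>
      define a where "a = c * real n / 2"
      have a: "2 \<le> a" "C \<le> a" using n c by (auto simp: a_def field_simps)
      have "a \<le> measure_pmf.expectation (insert_all p (pairs_seq n) Leaf) (\<lambda>t. real (height t))"
        using height[OF even pos] a(2) by (simp add: a_def)
      moreover have "pairs_seq n \<noteq> []" using length_pairs_seq[OF even] pos by auto
      ultimately have "(a\<^sup>2 - a) / (2 * real n) \<le> expected_avg_depth p (pairs_seq n)"
        using expected_avg_depth_ge_height[of "pairs_seq n" a p] a(1) length_pairs_seq[OF even] by simp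
      moreover have "c\<^sup>2 / 16 * real n = (a\<^sup>2 / 2) / (2 * real n)"
        using pos by (simp add: a_def field_simps power2_eq_square)
      moreover have "(a\<^sup>2 / 2) / (2 * real n) \<le> (a\<^sup>2 - a) / (2 * real n)"
        using mult_right_mono[OF a(1), of a] a(1)
        by (intro divide_right_mono) (auto simp: power2_eq_square)
      ultimately show "norm (expected_avg_depth p (pairs_seq n)) \<ge> c\<^sup>2 / 16 * norm (real n)"
        by simp
    qed
  qed (use c in simp)
qed

end
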